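(* For every real $q>1$, the sketch $q$-$\mathsf{PCSA}$ is weakly scale-invariant with base $q$, and \[ \mathcal{H}(q\text{-}\mathsf{PCSA})=\frac{H_0}{\ln q},\qquad \mathcal{I}(q\text{-}\mathsf{PCSA})=\frac{I_0}{\ln q},\qquad\text{hence}\qquad \mathsf{Fish}(q\text{-}\mathsf{PCSA})=\frac{H_0}{I_0}\approx 1.98016 . \]
   Context: A sketch is described by its induced distribution family: for each cardinality (Poissonized time) $\lambda>0$, a distribution $\psi_\lambda$ on a state space; $X_\lambda\sim\psi_\lambda$. Entropy $H(X_\lambda)=-\sum_x\psi_\lambda(x)\log_2\psi_\lambda(x)$ and Fisher information $I(\lambda)=\sum_x (\frac{\partial}{\partial\lambda}\psi_\lambda(x))^2/\psi_\lambda(x)$. A sketch is weakly scale-invariant with base $q>1$ if for all $\lambda>0$: $H(X_\lambda)=H(X_{q\lambda})$ and $I(\lambda)=q^2 I(q\lambda)$. For such a sketch $A$, define $\mathcal{H}(A)=\int_0^1 H(X_{q^r})\,dr$, $\mathcal{I}(A)=\int_0^1 q^{2r}I(q^r)\,dr$, and $\mathsf{Fish}(A)=\mathcal{H}(A)/\mathcal{I}(A)$. The sketch $q$-$\mathsf{PCSA}$: the state is a bit vector $(b_k)_{k\in\mathbb{Z}}$ whose coordinates are independent, with $\Pr(b_k=0)=e^{-\lambda/q^k}$ and $\Pr(b_k=1)=1-e^{-\lambda/q^k}$ at cardinality $\lambda$; its entropy and Fisher information are the sums over $k\in\mathbb Z$ of the entropies and Fisher informations of the individual coordinates. Constants: with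 $h(x)=-x\ln x-(1-x)\ln(1-x)$ and $g(x)=x^2/(e^x-1)$, $H_0=\frac{1}{\ln 2}\int_{-\infty}^\infty h(e^{-e^w})\,dw$ and $I_0=\int_{-\infty}^\infty g(e^w)\,dw$. *)

theory Defs
  imports "HOL-Analysis.Analysis"
begin

text \<open>Weak scale invariance with base q of a sketch, given by its entropy
  function H and Fisher information function I (as functions of the cardinality).\<close>
definition weakly_scale_invariant :: "real \<Rightarrow> (real \<Rightarrow> real) \<Rightarrow> (real \<Rightarrow> real) \<Rightarrow> bool" where
  "weakly_scale_invariant q H I \<longleftrightarrow>
     q > 1 \<and> (\<forall>t>0. H t = H (q * t) \<and> I t = q\<^sup>2 * I (q * t))"

definition xlog2 :: "real \<Rightarrow> real" where
  "xlog2 x = (if x = 0 then 0 else x * log 2 x)"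

definition bit_entropy :: "real \<Rightarrow> real" where
  "bit_entropy p0 = - xlog2 p0 - xlog2 (1 - p0)"

text \<open>q-PCSA: coordinate k (k an integer) satisfies Pr(b_k = 0) = exp(-lambda / q^k).\<close>
definition pcsa_p0 :: "real \<Rightarrow> int \<Rightarrow> real \<Rightarrow> real" where
  "pcsa_p0 q k t = exp (- t / q powi k)"

definition pcsa_coord_entropy :: "real \<Rightarrow> int \<Rightarrow> real \<Rightarrow> real" where
  "pcsa_coord_entropy q k t = bit_entropy (pcsa_p0 q k t)"

definition pcsa_coord_fisher :: "real \<Rightarrow> int \<Rightarrow> real \<Rightarrow> real" where
  "pcsa_coord_fisher q k t =
     (deriv (\<lambda>l. pcsa_p0 q k l) t)\<^sup>2 / pcsa_p0 q k t
   + (deriv (\<lambda>l. 1 - pcsa_p0 q k l) t)\<^sup>2 / (1 - pcsa_p0 q k t)"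

definition pcsa_H :: "real \<Rightarrow> real \<Rightarrow> real" where
  "pcsa_H q t = (\<Sum>\<^sub>\<infinity>k\<in>(UNIV::int set). pcsa_coord_entropy q k t)"

definition pcsa_I :: "real \<Rightarrow> real \<Rightarrow> real" where
  "pcsa_I q t = (\<Sum>\<^sub>\<infinity>k\<in>(UNIV::int set). pcsa_coord_fisher q k t)"

definition calH :: "real \<Rightarrow> (real \<Rightarrow> real) \<Rightarrow> real" where
  "calH q H = integral {0..1} (\<lambda>r. H (q powr r))"

definition calI :: "real \<Rightarrow> (real \<Rightarrow> real) \<Rightarrow> real" where
  "calI q I = integral {0..1} (\<lambda>r. q powr (2 * r) * I (q powr r))"

definition Fish :: "real \<Rightarrow> (real \<Rightarrow> real) \<Rightarrow> (real \<Rightarrow> real) \<Rightarrow> real" where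
  "Fish q H I = calH q H / calI q I"

definition hnat :: "real \<Rightarrow> real" where
  "hnat x = (if x = 0 then 0 else - x * ln x) - (if x = 1 then 0 else (1 - x) * ln (1 - x))"

definition gfun :: "real \<Rightarrow> real" where
  "gfun x = x\<^sup>2 / (exp x - 1)"

definition H0_integrand :: "real \<Rightarrow> real" where
  "H0_integrand w = hnat (exp (- exp w))"

definition I0_integrand :: "real \<Rightarrow> real" where
  "I0_integrand w = gfun (exp w)"

definition H0 :: real where
  "H0 = (1 / ln 2) * integral UNIV H0_integrand"

definition I0 :: real where
  "I0 = integral UNIV I0_integrand"

end

theory Submission
  imports Defs "HOL-Real_Asymp.Real_Asymp"
begin

text \<open>
  In the logarithmic coordinate $w = \ln t$, the coordinate $k$ of the sketch contributes
  $\varphi(w - k \ln q)$ to the entropy (and to $t^2$ times the Fisher information), with one fixed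
  profile $\varphi$ decaying like $e^{-|w|/2}$. Summing over $k$ periodizes $\varphi$ with period
  $\ln q$, which gives scale invariance, and integrating over one period unfolds to
  $\frac{1}{\ln q}\int\varphi$.

  For the constants, expanding $1/(e^x-1)$ and $-\ln(1-e^{-x})$ in powers of $e^{-x}$ and integrating
  termwise (by a Frullani integral in the second case) gives $I_0 = \sum_{n\ge1} n^{-2}$ and
  $H_0 \ln 2 = 1 + \sum_{n\ge1} \frac{1}{n}\ln(1+\frac1n)$. Both series are evaluated from their first
  seven terms plus a telescoping bound on the tail.
\<close>

section \<open>Periodization over the integers\<close>

text \<open>For a nonnegative integrand, finite limits of an antiderivative at both ends already
  yield integrability. The \<open>nn_integral\<close> form is the one that the termwise integrations
  below consume.\<close>

lemma nn_integral_FTC_UNIV: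
  fixes f F :: "real \<Rightarrow> real"
  assumes F: "\<And>x. (F has_real_derivative f x) (at x)"
    and cont: "continuous_on UNIV f"
    and nonneg: "\<And>x. 0 \<le> f x"
    and lim: "(F \<longlongrightarrow> a) at_bot" "(F \<longlongrightarrow> b) at_top"
  shows "(\<integral>\<^sup>+x. ennreal (f x) \<partial>lborel) = ennreal (b - a)"
proof -
  have I: "isCont f x" for x
    using cont by (simp add: continuous_on_eq_continuous_at)
  have bot: "((F \<circ> real_of_ereal) \<longlongrightarrow> a) (at_right (-\<infinity>))"
    and top: "((F \<circ> real_of_ereal) \<longlongrightarrow> b) (at_left \<infinity>)"
    using lim by (simp_all only: ereal_tendsto_simps)
  have 1: "set_integrable lborel (einterval (-\<infinity>) \<infinity>) f"
    and 2: "(LBINT x=-\<infinity>..\<infinity>. f x) = b - a"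
    by (rule interval_integral_FTC_nonneg[where F = F]; use F I nonneg bot top in auto)+
  have "integrable lborel f"
    using 1 by (simp add: set_integrable_def)
  moreover have "integral\<^sup>L lborel f = b - a"
    using 2 by (simp add: interval_lebesgue_integral_def set_lebesgue_integral_def)
  ultimately show ?thesis
    using nonneg by (simp add: nn_integral_eq_integral)
qed

lemma summable_on_geometric_int_abs:
  fixes \<rho> :: real
  assumes "0 \<le> \<rho>" "\<rho> < 1"
  shows "(\<lambda>k::int. \<rho> ^ nat \<bar>k\<bar>) summable_on UNIV"
proof -
  have s: "(\<lambda>n::nat. \<rho> ^ n) summable_on UNIV"
    using assms by (intro summable_nonneg_imp_summable_on) auto
  have "(\<lambda>k::int. \<rho> ^ nat \<bar>k\<bar>) summable_on range int"
    by (subst summable_on_reindex) (use s in \<open>auto simp: o_def\<close>)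
  moreover have "(\<lambda>k::int. \<rho> ^ nat \<bar>k\<bar>) summable_on range (\<lambda>n. - int n)"
    by (subst summable_on_reindex) (use s in \<open>auto simp: o_def inj_on_def\<close>)
  \<comment> \<open>The two ranges overlap in 0, which does no harm to summability.\<close>
  ultimately have "(\<lambda>k::int. \<rho> ^ nat \<bar>k\<bar>) summable_on (range int \<union> range (\<lambda>n. - int n))"
    by (rule summable_on_union)
  moreover have "range int \<union> range (\<lambda>n. - int n) = UNIV"
  proof -
    have "k \<in> range int \<union> range (\<lambda>n. - int n)" for k
      by (cases k rule: int_cases2) auto
    then show ?thesis by blast
  qed
  ultimately show ?thesis by simp
qed

text \<open>The triangle inequality moves the shift \<open>s\<close> into a constant factor
  exp(|s|/2), leaving a two-sided geometric series in |k| with ratio exp(-L/2).\<close>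

lemma summable_on_int_translates:
  fixes \<phi> :: "real \<Rightarrow> real"
  assumes nonneg: "\<And>w. 0 \<le> \<phi> w"
    and decay: "\<And>w. \<phi> w \<le> C * exp (- \<bar>w\<bar> / 2)"
    and L: "L > 0"
  shows "(\<lambda>k::int. \<phi> (s - of_int k * L)) summable_on UNIV"
proof (rule summable_on_comparison_test)
  define \<rho> where "\<rho> = exp (- L / 2)"
  show "(\<lambda>k::int. (C * exp (\<bar>s\<bar> / 2)) * \<rho> ^ nat \<bar>k\<bar>) summable_on UNIV"
    using L by (intro summable_on_cmult_right summable_on_geometric_int_abs) (auto simp: \<rho>_def)
  show "\<phi> (s - of_int k * L) \<le> C * exp (\<bar>s\<bar> / 2) * \<rho> ^ nat \<bar>k\<bar>" for k
  proof -
    have "0 \<le> C * exp (- \<bar>0\<bar> / 2)"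
      using nonneg[of 0] decay[of 0] by linarith
    then have C: "0 \<le> C" by simp
    have "\<rho> ^ nat \<bar>k\<bar> = exp (- \<bar>of_int k * L\<bar> / 2)"
      using L by (simp add: \<rho>_def exp_of_nat_mult[symmetric] abs_mult)
    moreover have "- \<bar>s - of_int k * L\<bar> / 2 \<le> \<bar>s\<bar> / 2 + - \<bar>of_int k * L\<bar> / 2"
      using abs_triangle_ineq4[of s "s - of_int k * L"] by simp
    ultimately have "C * exp (- \<bar>s - of_int k * L\<bar> / 2) \<le> C * (exp (\<bar>s\<bar> / 2) * \<rho> ^ nat \<bar>k\<bar>)"
      using C by (intro mult_left_mono) (auto simp flip: exp_add)
    then show ?thesis
      using decay[of "s - of_int k * L"] by (simp add: mult.assoc)
  qed
qed (use nonneg in auto)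

text \<open>Unfolding: substituting r = u + k in the k-th term leaves the integrand phi(u L), the
  same for all k, times the indicator of J at u + k. These indicators sum to 1, so the integral over
  one period becomes one over the whole line. With nonnegative integrals, both exchanges of sum and
  integral ask only for measurability.\<close>

lemma has_integral_periodization:
  fixes \<phi> :: "real \<Rightarrow> real"
  assumes meas [measurable]: "\<phi> \<in> borel_measurable borel"
    and nonneg: "\<And>w. 0 \<le> \<phi> w"
    and summ: "\<And>s. (\<lambda>k::int. \<phi> (s - of_int k * L)) summable_on UNIV"
    and L: "L > 0"
    and A: "(\<integral>\<^sup>+w. ennreal (\<phi> w) \<partial>lborel) = ennreal A" "0 \<le> A"
  shows "((\<lambda>r. \<Sum>\<^sub>\<infinity>k\<in>(UNIV::int set). \<phi> (r * L - of_int k * L)) has_integral (A / L)) {0..1}"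
proof -
  \<comment> \<open>Half-open, so that the integer translates tile the line without overlap.\<close>
  define J where "J = {0..<1::real}"
  \<comment> \<open>The integers are enumerated by \<open>int_decode\<close> so that the results on
    \<open>suminf\<close> over the naturals apply.\<close>
  define t where "t n r = \<phi> (r * L - of_int (int_decode n) * L)" for n r
  define \<Phi> where "\<Phi> r = (\<Sum>n. t n r)" for r
  have [measurable]: "t n \<in> borel_measurable borel" for n
    unfolding t_def by measurable
  have t0: "0 \<le> t n r" for n r
    using nonneg by (simp add: t_def)
  have t_summ: "(\<lambda>n. t n r) summable_on UNIV" for r
    using summ[of "r * L"] summable_on_reindex_bij_betw[OF bij_int_decode, of "\<lambda>k. \<phi> (r * L - of_int k * L)"]
    by (simp add: t_def)
  then have t_sums: "summable (\<lambda>n. t n r)" for r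
    by (rule summable_on_imp_summable)
  have \<Phi>_eq: "(\<Sum>\<^sub>\<infinity>k\<in>(UNIV::int set). \<phi> (r * L - of_int k * L)) = \<Phi> r" for r
  proof -
    have "(\<Sum>\<^sub>\<infinity>k\<in>(UNIV::int set). \<phi> (r * L - of_int k * L)) = (\<Sum>\<^sub>\<infinity>n. t n r)"
      unfolding t_def by (rule infsum_reindex_bij_betw[OF bij_int_decode, symmetric])
    also have "\<dots> = \<Phi> r"
      unfolding \<Phi>_def using has_sum_imp_sums[OF has_sum_infsum[OF t_summ]] by (simp add: sums_iff)
    finally show ?thesis .
  qed
  have \<Phi>0: "0 \<le> \<Phi> r" for r
    unfolding \<Phi>_def by (intro suminf_nonneg t_sums t0)
  have [measurable]: "\<Phi> \<in> borel_measurable borel"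
    unfolding \<Phi>_def by measurable
  have [measurable]: "J \<in> sets borel"
    by (simp add: J_def)
  have shift: "(\<integral>\<^sup>+r. ennreal (t n r) * indicator J r \<partial>lborel)
      = (\<integral>\<^sup>+u. ennreal (\<phi> (u * L)) * indicator J (u + of_int (int_decode n)) \<partial>lborel)" for n
    by (subst nn_integral_real_affine[where c = 1 and t = "of_int (int_decode n)"])
      (auto simp: t_def algebra_simps)
  have one: "(\<Sum>n. indicator J (u + of_int (int_decode n)) :: ennreal) = 1" for u
  proof -
    define m where "m = int_encode (- \<lfloor>u\<rfloor>)"
    have "indicator J (u + of_int (int_decode n)) = (if n = m then 1 else 0 :: ennreal)" for n
    proof -
      have "u + of_int (int_decode n) \<in> J \<longleftrightarrow> int_decode n = - \<lfloor>u\<rfloor>"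
        unfolding J_def by (auto simp: ) linarith+
      also have "\<dots> \<longleftrightarrow> n = m"
        by (auto simp: m_def) (metis int_decode_inverse)
      finally show ?thesis by (simp add: indicator_def)
    qed
    then show ?thesis
      using sums_single[of m "\<lambda>_. 1 :: ennreal"] by (simp add: sums_iff)
  qed
  have "(\<integral>\<^sup>+r. ennreal (indicator J r * \<Phi> r) \<partial>lborel) = (\<integral>\<^sup>+r. (\<Sum>n. ennreal (t n r) * indicator J r) \<partial>lborel)"
  proof (rule nn_integral_cong)
    fix r
    have "ennreal (\<Phi> r) = (\<Sum>n. ennreal (t n r))"
      unfolding \<Phi>_def by (intro suminf_ennreal2[symmetric] t0 t_sums)
    then show "ennreal (indicator J r * \<Phi> r) = (\<Sum>n. ennreal (t n r) * indicator J r)"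
      by (simp add: indicator_def)
  qed
  also have "\<dots> = (\<Sum>n. \<integral>\<^sup>+r. ennreal (t n r) * indicator J r \<partial>lborel)"
    by (rule nn_integral_suminf) measurable
  also have "\<dots> = (\<integral>\<^sup>+u. (\<Sum>n. ennreal (\<phi> (u * L)) * indicator J (u + of_int (int_decode n))) \<partial>lborel)"
    unfolding shift by (rule nn_integral_suminf[symmetric]) measurable
  also have "\<dots> = (\<integral>\<^sup>+u. ennreal (\<phi> (u * L)) \<partial>lborel)"
    by (simp add: one)
  also have "\<dots> = ennreal (A / L)"
  proof -
    have "ennreal A = ennreal L * (\<integral>\<^sup>+u. ennreal (\<phi> (u * L)) \<partial>lborel)"
      using nn_integral_real_affine[of "\<lambda>w. ennreal (\<phi> w)" L 0] L A by (simp add: mult.commute)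
    then have "ennreal (1 / L) * ennreal A = (ennreal (1 / L) * ennreal L) * (\<integral>\<^sup>+u. ennreal (\<phi> (u * L)) \<partial>lborel)"
      by (simp add: mult.assoc)
    then show ?thesis
      using L A by (simp add: ennreal_mult[symmetric])
  qed
  finally have "((\<lambda>r. indicator J r * \<Phi> r) has_integral (A / L)) UNIV"
    using \<Phi>0 L A by (intro nn_integral_has_integral) auto
  then have "((\<lambda>r. if r \<in> J then \<Phi> r else 0) has_integral (A / L)) UNIV"
    by (rule has_integral_eq[rotated]) (simp add: indicator_def)
  then have "(\<Phi> has_integral (A / L)) J"
    by (simp add: has_integral_restrict_UNIV)
  \<comment> \<open>The closed interval differs from J only in the point 1, a negligible
    set.\<close>
  then have "(\<Phi> has_integral (A / L)) {0..1}"
    by (rule has_integral_spike_set_eq[THEN iffD1, rotated 2])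
      (auto simp: J_def intro!: negligible_subset[OF negligible_sing[of 1]])
  then show ?thesis
    by (simp add: \<Phi>_eq)
qed

section \<open>The integrals of the two profiles\<close>

text \<open>In the variable x = e^w this is the integral of x e^(-n x) over x > 0; \<open>F\<close>
  is the antiderivative found by parts.\<close>

lemma nn_integral_moment_Gumbel:
  fixes n :: real
  assumes "n > 0"
  shows "(\<integral>\<^sup>+w. ennreal ((exp w)\<^sup>2 * exp (- (n * exp w))) \<partial>lborel) = ennreal ((1 / n)\<^sup>2)"
proof -
  define F where "F w = - (exp w * exp (- (n * exp w)) / n + exp (- (n * exp w)) / n\<^sup>2)" for w :: real
  have "(\<integral>\<^sup>+w. ennreal ((exp w)\<^sup>2 * exp (- (n * exp w))) \<partial>lborel) = ennreal (0 - (- 1 / n\<^sup>2))"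
  proof (rule nn_integral_FTC_UNIV[where F = F])
    show "(F has_real_derivative (exp w)\<^sup>2 * exp (- (n * exp w))) (at w)" for w
      unfolding F_def using assms
      by (auto intro!: derivative_eq_intros simp: field_simps power2_eq_square)
    show "(F \<longlongrightarrow> - 1 / n\<^sup>2) at_bot" "(F \<longlongrightarrow> 0) at_top"
      unfolding F_def using assms by (real_asymp simp: power2_eq_square field_simps)+
  qed (auto intro!: continuous_intros)
  then show ?thesis
    by (simp add: power_divide)
qed

text \<open>The integrand is the density of a shifted logarithm of a standard exponential variable.
  The shift \<open>s\<close> is kept because the Frullani integral integrates over it.\<close>

lemma nn_integral_Gumbel:
  "(\<integral>\<^sup>+w. ennreal (exp (w + s) * exp (- exp (w + s))) \<partial>lborel) = 1"
proof -
  have "(\<integral>\<^sup>+w. ennreal (exp (w + s) * exp (- exp (w + s))) \<partial>lborel) = ennreal (0 - (- 1))"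
  proof (rule nn_integral_FTC_UNIV[where F = "\<lambda>w. - exp (- exp (w + s))"])
    show "((\<lambda>w. - exp (- exp (w + s))) \<longlongrightarrow> - 1) at_bot" "((\<lambda>w. - exp (- exp (w + s))) \<longlongrightarrow> 0) at_top"
      by real_asymp+
  qed (auto intro!: derivative_eq_intros continuous_intros)
  then show ?thesis by simp
qed

text \<open>The difference is the integral of the Gumbel density \<open>d w s\<close> over s in
  [a, b]. By Tonelli the integral over w comes first, is 1 for each s, and leaves the length b -
  a.\<close>

lemma nn_integral_Frullani_exp:
  fixes a b :: real
  assumes "a \<le> b"
  shows "(\<integral>\<^sup>+w. ennreal (exp (- exp (w + a)) - exp (- exp (w + b))) \<partial>lborel) = ennreal (b - a)"
proof -
  define d where "d w s = exp (w + s) * exp (- exp (w + s))" for w s :: real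
  have m [measurable]: "(\<lambda>(w, s). d w s) \<in> borel_measurable (borel \<Otimes>\<^sub>M borel)"
    unfolding d_def by measurable
  have "ennreal (exp (- exp (w + a)) - exp (- exp (w + b))) = (\<integral>\<^sup>+s. ennreal (d w s) * indicator {a..b} s \<partial>lborel)" for w
  proof -
    have "(\<integral>\<^sup>+s. ennreal (d w s) * indicator {a..b} s \<partial>lborel) = (- exp (- exp (w + b))) - (- exp (- exp (w + a)))"
      by (rule nn_integral_FTC_Icc) (auto simp: d_def assms intro!: derivative_eq_intros)
    then show ?thesis by simp
  qed
  then have "(\<integral>\<^sup>+w. ennreal (exp (- exp (w + a)) - exp (- exp (w + b))) \<partial>lborel)
      = (\<integral>\<^sup>+w. (\<integral>\<^sup>+s. ennreal (d w s) * indicator {a..b} s \<partial>lborel) \<partial>lborel)"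
    by simp
  also have "\<dots> = (\<integral>\<^sup>+s. (\<integral>\<^sup>+w. ennreal (d w s) * indicator {a..b} s \<partial>lborel) \<partial>lborel)"
    by (rule lborel_pair.Fubini') (simp add: d_def)
  also have "\<dots> = (\<integral>\<^sup>+s. indicator {a..b} s \<partial>lborel)"
  proof (rule nn_integral_cong)
    fix s :: real
    have "(\<integral>\<^sup>+w. ennreal (d w s) * indicator {a..b} s \<partial>lborel) = (\<integral>\<^sup>+w. ennreal (d w s) \<partial>lborel) * indicator {a..b} s"
      by (rule nn_integral_multc) (simp add: d_def)
    then show "(\<integral>\<^sup>+w. ennreal (d w s) * indicator {a..b} s \<partial>lborel) = indicator {a..b} s"
      by (simp add: d_def nn_integral_Gumbel)
  qed
  also have "\<dots> = ennreal (b - a)"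
    using assms by simp
  finally show ?thesis .
qed

lemma I0_integrand_sums:
  "(\<lambda>k. (exp w)\<^sup>2 * exp (- (real (Suc k) * exp w))) sums I0_integrand w"
proof -
  define x where "x = exp w"
  have x: "x > 0" by (simp add: x_def)
  have "(\<lambda>k. x\<^sup>2 * exp (-x) * exp (-x) ^ k) sums (x\<^sup>2 * exp (-x) * (1 / (1 - exp (-x))))"
    using x by (intro sums_mult geometric_sums) auto
  moreover have "x\<^sup>2 * exp (-x) * exp (-x) ^ k = x\<^sup>2 * exp (- (real (Suc k) * x))" for k
    by (simp add: exp_of_nat_mult[symmetric] exp_add[symmetric] algebra_simps)
  moreover have "x\<^sup>2 * exp (-x) * (1 / (1 - exp (-x))) = I0_integrand w"
    using x by (simp add: I0_integrand_def gfun_def x_def[symmetric] exp_minus field_simps)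
  ultimately show ?thesis unfolding x_def by (simp only:)
qed

lemma inverse_squares_summable: "summable (\<lambda>k. (1 / real (Suc k))\<^sup>2)"
  using inverse_squares_sums by (simp add: sums_iff power_divide add.commute)

lemma nn_integral_I0_integrand:
  "(\<integral>\<^sup>+w. ennreal (I0_integrand w) \<partial>lborel) = ennreal (\<Sum>k. (1 / real (Suc k))\<^sup>2)"
proof -
  have "(\<integral>\<^sup>+w. ennreal (I0_integrand w) \<partial>lborel)
      = (\<integral>\<^sup>+w. (\<Sum>k. ennreal ((exp w)\<^sup>2 * exp (- (real (Suc k) * exp w)))) \<partial>lborel)"
  proof (rule nn_integral_cong)
    fix w
    show "ennreal (I0_integrand w) = (\<Sum>k. ennreal ((exp w)\<^sup>2 * exp (- (real (Suc k) * exp w))))"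
      using I0_integrand_sums[of w] by (subst suminf_ennreal2) (auto simp: sums_iff)
  qed
  also have "\<dots> = (\<Sum>k. \<integral>\<^sup>+w. ennreal ((exp w)\<^sup>2 * exp (- (real (Suc k) * exp w))) \<partial>lborel)"
    by (rule nn_integral_suminf) measurable
  also have "\<dots> = (\<Sum>k. ennreal ((1 / real (Suc k))\<^sup>2))"
    by (simp only: nn_integral_moment_Gumbel of_nat_0_less_iff zero_less_Suc)
  also have "\<dots> = ennreal (\<Sum>k. (1 / real (Suc k))\<^sup>2)"
    by (intro suminf_ennreal2 inverse_squares_summable) auto
  finally show ?thesis .
qed

text \<open>With p = exp(-e^w), the subtracted term is -p ln p. In the other half, -(1-p) ln(1-p),
  the factor 1-p is multiplied into the series of -ln(1-p): the powers p^n alone are not integrable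
  in w, since p tends to 1 at minus infinity, but p^n - p^(n+1) is a Frullani integrand because p^n
  = exp(-exp(w + ln n)).\<close>

lemma H0_integrand_sums:
  "(\<lambda>k. 1 / real (Suc k) * (exp (- exp (w + ln (real (Suc k)))) - exp (- exp (w + ln (real (Suc (Suc k)))))))
     sums (H0_integrand w - exp w * exp (- exp w))"
proof -
  define p where "p = exp (- exp w)"
  have p: "0 < p" "p < 1" by (auto simp: p_def)
  have e: "exp (- exp (w + ln (real (Suc k)))) = p ^ Suc k" for k
    unfolding p_def exp_of_nat_mult[symmetric] by (simp add: exp_add mult.commute)
  have "(\<lambda>k. p ^ k / real k) sums - ln (1 - p)"
    using p sums_minus[OF ln_series'[of "- p"]] by simp
  \<comment> \<open>The term at k = 0 is 1/0 = 0, so dropping it leaves the sum unchanged.\<close>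
  then have "(\<lambda>k. p ^ Suc k / real (Suc k)) sums - ln (1 - p)"
    by (subst sums_Suc_iff) simp
  then have "(\<lambda>k. (1 - p) * (p ^ Suc k / real (Suc k))) sums ((1 - p) * - ln (1 - p))"
    by (rule sums_mult)
  moreover have "(1 - p) * (p ^ Suc k / real (Suc k)) = 1 / real (Suc k) * (p ^ Suc k - p ^ Suc (Suc k))" for k
    by (simp add: left_diff_distrib diff_divide_distrib)
  moreover have "H0_integrand w - exp w * exp (- exp w) = (1 - p) * - ln (1 - p)"
    using p by (simp add: H0_integrand_def hnat_def flip: p_def) (simp add: p_def)
  ultimately show ?thesis
    by (simp only: e)
qed

lemma ln_series_summable: "summable (\<lambda>k. 1 / real (Suc k) * ln (1 + 1 / real (Suc k)))"
proof (rule summable_comparison_test'[OF inverse_squares_summable])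
  fix k
  define x where "x = 1 / real (Suc k)"
  have "0 \<le> x" by (simp add: x_def)
  then have "norm (x * ln (1 + x)) \<le> x\<^sup>2"
    by (simp add: power2_eq_square mult_left_mono ln_add_one_self_le_self)
  then show "norm (1 / real (Suc k) * ln (1 + 1 / real (Suc k))) \<le> (1 / real (Suc k))\<^sup>2"
    unfolding x_def .
qed

text \<open>The summand 1 is the Gumbel mass of the term -p ln p; the n-th term of the series is the
  Frullani integral with a = ln n and b = ln (n+1), weighted by 1/n.\<close>

lemma nn_integral_H0_integrand:
  "(\<integral>\<^sup>+w. ennreal (H0_integrand w) \<partial>lborel)
     = ennreal (1 + (\<Sum>k. 1 / real (Suc k) * ln (1 + 1 / real (Suc k))))"
proof -
  define t where "t k w = 1 / real (Suc k) * (exp (- exp (w + ln (real (Suc k)))) - exp (- exp (w + ln (real (Suc (Suc k))))))"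
    for k w
  have t0: "0 \<le> t k w" for k w
    by (auto simp: t_def)
  have t_int: "(\<integral>\<^sup>+w. ennreal (t k w) \<partial>lborel) = ennreal (1 / real (Suc k) * ln (1 + 1 / real (Suc k)))" for k
  proof -
    have "(\<integral>\<^sup>+w. ennreal (t k w) \<partial>lborel) = ennreal (1 / real (Suc k)) *
       (\<integral>\<^sup>+w. ennreal (exp (- exp (w + ln (real (Suc k)))) - exp (- exp (w + ln (real (Suc (Suc k)))))) \<partial>lborel)"
      unfolding t_def by (subst ennreal_mult') (auto intro!: nn_integral_cmult)
    also have "\<dots> = ennreal (1 / real (Suc k)) * ennreal (ln (real (Suc (Suc k))) - ln (real (Suc k)))"
      by (subst nn_integral_Frullani_exp) auto
    also have "ln (real (Suc (Suc k))) - ln (real (Suc k)) = ln (1 + 1 / real (Suc k))"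
    proof -
      have "1 + 1 / real (Suc k) = real (Suc (Suc k)) / real (Suc k)"
        by (simp add: field_simps)
      then show ?thesis by (simp add: ln_div del: of_nat_Suc)
    qed
    also have "ennreal (1 / real (Suc k)) * ennreal (ln (1 + 1 / real (Suc k))) = ennreal (1 / real (Suc k) * ln (1 + 1 / real (Suc k)))"
      by (rule ennreal_mult'[symmetric]) simp
    finally show ?thesis .
  qed
  have "(\<integral>\<^sup>+w. ennreal (H0_integrand w) \<partial>lborel)
     = (\<integral>\<^sup>+w. ennreal (exp w * exp (- exp w)) + (\<Sum>k. ennreal (t k w)) \<partial>lborel)"
  proof (rule nn_integral_cong)
    fix w
    have s: "(\<lambda>k. t k w) sums (H0_integrand w - exp w * exp (- exp w))"
      unfolding t_def by (rule H0_integrand_sums)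
    then have "0 \<le> H0_integrand w - exp w * exp (- exp w)"
      using t0 by (metis sums_iff suminf_nonneg)
    moreover have "(\<Sum>k. ennreal (t k w)) = ennreal (H0_integrand w - exp w * exp (- exp w))"
      using s t0 by (subst suminf_ennreal2) (auto simp: sums_iff)
    ultimately show "ennreal (H0_integrand w) = ennreal (exp w * exp (- exp w)) + (\<Sum>k. ennreal (t k w))"
      by (simp flip: ennreal_plus)
  qed
  also have "\<dots> = (\<integral>\<^sup>+w. ennreal (exp w * exp (- exp w)) \<partial>lborel) + (\<integral>\<^sup>+w. (\<Sum>k. ennreal (t k w)) \<partial>lborel)"
    unfolding t_def by (rule nn_integral_add) measurable
  also have "(\<integral>\<^sup>+w. ennreal (exp w * exp (- exp w)) \<partial>lborel) = 1"
    using nn_integral_Gumbel[of 0] by simp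
  also have "(\<integral>\<^sup>+w. (\<Sum>k. ennreal (t k w)) \<partial>lborel) = (\<Sum>k. \<integral>\<^sup>+w. ennreal (t k w) \<partial>lborel)"
    unfolding t_def by (rule nn_integral_suminf) measurable
  also have "\<dots> = ennreal (\<Sum>k. 1 / real (Suc k) * ln (1 + 1 / real (Suc k)))"
    unfolding t_int by (intro suminf_ennreal2 ln_series_summable) auto
  also have "1 + \<dots> = ennreal (1 + (\<Sum>k. 1 / real (Suc k) * ln (1 + 1 / real (Suc k))))"
  proof -
    have "0 \<le> (\<Sum>k. 1 / real (Suc k) * ln (1 + 1 / real (Suc k)))"
      by (intro suminf_nonneg ln_series_summable) simp
    then show ?thesis by (subst ennreal_plus) simp_all
  qed
  finally show ?thesis .
qed

section \<open>Numerical evaluation of the series\<close>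

text \<open>The differences of \<open>F\<close> telescope to \<open>F N\<close>, so an approximate
  closed form for the tail becomes a rigorous bound once its one-step difference is compared with
  \<open>f\<close>.\<close>

lemma sums_le_partial_plus_telescope:
  fixes f F :: "nat \<Rightarrow> real"
  assumes "f sums s" "\<And>k. k \<ge> N \<Longrightarrow> f k \<le> F k - F (Suc k)" "F \<longlonglongrightarrow> 0"
  shows "s \<le> (\<Sum>k<N. f k) + F N"
proof -
  have 1: "(\<lambda>k. f (k + N)) sums (s - (\<Sum>k<N. f k))"
    using assms(1) by (rule sums_split_initial_segment)
  have 2: "(\<lambda>k. F (k + N) - F (Suc (k + N))) sums (F (0 + N) - 0)"
    using telescope_sums'[OF LIMSEQ_ignore_initial_segment[OF assms(3)], of N] by simp
  show ?thesis
    using sums_le[OF _ 1 2] assms(2) by simp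
qed

lemma sums_ge_partial_plus_telescope:
  fixes f F :: "nat \<Rightarrow> real"
  assumes "f sums s" "\<And>k. k \<ge> N \<Longrightarrow> F k - F (Suc k) \<le> f k" "F \<longlonglongrightarrow> 0"
  shows "(\<Sum>k<N. f k) + F N \<le> s"
proof -
  have "- s \<le> (\<Sum>k<N. - f k) + - F N"
    using assms by (intro sums_le_partial_plus_telescope sums_minus)
      (auto intro: tendsto_eq_intros simp: algebra_simps)
  then show ?thesis by (simp add: sum_negf)
qed

text \<open>The gap vanishes at 0 and has derivative y^5/(1+y), the remainder of the truncated
  geometric series of 1/(1+y).\<close>

lemma ln_one_plus_le_poly5:
  fixes x :: real
  assumes "0 \<le> x"
  shows "ln (1 + x) \<le> x - x^2/2 + x^3/3 - x^4/4 + x^5/5"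
proof -
  define g where "g y = y - y^2/2 + y^3/3 - y^4/4 + y^5/5 - ln (1 + y)" for y :: real
  have "g 0 \<le> g x"
  proof (rule DERIV_nonneg_imp_nondecreasing[OF assms])
    fix y :: real assume y: "0 \<le> y" "y \<le> x"
    have "(g has_real_derivative y^5 / (1 + y)) (at y)"
      unfolding g_def using y
      by (auto intro!: derivative_eq_intros simp: field_simps eval_nat_numeral)
    then show "\<exists>d. (g has_real_derivative d) (at y) \<and> 0 \<le> d"
      using y by (auto intro!: exI[of _ "y^5 / (1 + y)"])
  qed
  then show ?thesis by (simp add: g_def)
qed

lemma ln_one_plus_ge_poly6:
  fixes x :: real
  assumes "0 \<le> x"
  shows "x - x^2/2 + x^3/3 - x^4/4 + x^5/5 - x^6/6 \<le> ln (1 + x)"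
proof -
  define g where "g y = ln (1 + y) - (y - y^2/2 + y^3/3 - y^4/4 + y^5/5 - y^6/6)" for y :: real
  have "g 0 \<le> g x"
  proof (rule DERIV_nonneg_imp_nondecreasing[OF assms])
    fix y :: real assume y: "0 \<le> y" "y \<le> x"
    have "(g has_real_derivative y^6 / (1 + y)) (at y)"
      unfolding g_def using y
      by (auto intro!: derivative_eq_intros simp: field_simps eval_nat_numeral)
    then show "\<exists>d. (g has_real_derivative d) (at y) \<and> 0 \<le> d"
      using y by (auto intro!: exI[of _ "y^6 / (1 + y)"])
  qed
  then show ?thesis by (simp add: g_def)
qed


text \<open>
  With $a = 1/n$, the Euler--Maclaurin expansion of $\sum_{k\ge n}\frac1k\ln(1+\frac1k)$ is
  $a + a^2/4 + a^3/36 - a^4/48 + \dots$; replacing $-1/48$ by a slightly larger or smaller $c$ makes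
  it an upper or a lower bound. The map $a \mapsto a/(1+a)$ is $n \mapsto n+1$.
\<close>
definition log_tail :: "real \<Rightarrow> real \<Rightarrow> real" where
  "log_tail c a = a + a^2/4 + a^3/36 + c * a^4"

text \<open>Clearing denominators turns the step from n to n+1 into a polynomial in a, so the
  comparisons below become polynomial identities.\<close>

lemma log_tail_step:
  fixes a :: real
  assumes "a > 0"
  shows "(1 + a)^4 * log_tail c (a / (1 + a)) = a * (1 + a)^3 + a^2 * (1 + a)^2 / 4 + a^3 * (1 + a) / 36 + c * a^4"
proof -
  define b where "b = a / (1 + a)"
  have ab: "a = b * (1 + a)" using assms by (simp add: b_def)
  have "(1 + a)^4 * log_tail c b = (b * (1 + a)) * (1 + a)^3 + (b * (1 + a))^2 * (1 + a)^2 / 4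
      + (b * (1 + a))^3 * (1 + a) / 36 + c * (b * (1 + a))^4"
    by (simp add: log_tail_def power_mult_distrib eval_nat_numeral field_simps)
  then show ?thesis
    by (simp only: ab[symmetric] flip: b_def)
qed

text \<open>After multiplication by (1+a)^4 the gap is a^5 times a polynomial with constant term 4
  (1/48 - 1/50) = 1/300 > 0; for a at most 1/8 the negative higher terms cannot outweigh the
  positive ones.\<close>

lemma log_tail_upper:
  fixes a :: real
  assumes "0 < a" "a \<le> 1/8"
  shows "a * ln (1 + a) \<le> log_tail (-1/50) a - log_tail (-1/50) (a / (1 + a))"
proof -
  have q: "0 \<le> 1/300 + 37/900 * a - 167/900 * a^2 - 83/150 * a^3 - 11/20 * a^4 - 1/5 * a^5"
  proof -
    \<comment> \<open>With each power bounded by the previous one, the claim is linear in the powers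
      of a.\<close>
    have "a^2 \<le> a * (1/8)" "a^3 \<le> a^2 * (1/8)" "a^4 \<le> a^3 * (1/8)" "a^5 \<le> a^4 * (1/8)"
      using assms by (simp_all add: eval_nat_numeral mult_left_mono)
    then show ?thesis using assms by linarith
  qed
  have "a * ln (1 + a) \<le> a * (a - a^2/2 + a^3/3 - a^4/4 + a^5/5)"
    using assms by (intro mult_left_mono ln_one_plus_le_poly5) auto
  also have "\<dots> \<le> log_tail (-1/50) a - log_tail (-1/50) (a / (1 + a))"
  proof -
    have "(1 + a)^4 * (log_tail (-1/50) a - log_tail (-1/50) (a / (1 + a)) - a * (a - a^2/2 + a^3/3 - a^4/4 + a^5/5))
       = a^5 * (1/300 + 37/900 * a - 167/900 * a^2 - 83/150 * a^3 - 11/20 * a^4 - 1/5 * a^5)"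
      unfolding right_diff_distrib log_tail_step[OF assms(1)]
      unfolding log_tail_def by (simp add: eval_nat_numeral field_simps)
    also have "\<dots> \<ge> 0" using q assms by simp
    finally show ?thesis using assms by (simp add: zero_le_mult_iff)
  qed
  finally show ?thesis .
qed

text \<open>Here the constant term of the remaining polynomial is 4 (1/48 - 1/40) = -1/60, which
  dominates for a at most 1/8.\<close>

lemma log_tail_lower:
  fixes a :: real
  assumes "0 < a" "a \<le> 1/8"
  shows "log_tail (-1/40) a - log_tail (-1/40) (a / (1 + a)) \<le> a * ln (1 + a)"
proof -
  have q: "-1/60 + 1/90 * a - 7/180 * a^2 + 13/120 * a^3 + 9/20 * a^4 + 7/15 * a^5 + 1/6 * a^6 \<le> 0"
  proof -
    have "a^2 \<le> a * (1/8)" "a^3 \<le> a^2 * (1/8)" "a^4 \<le> a^3 * (1/8)" "a^5 \<le> a^4 * (1/8)" "a^6 \<le> a^5 * (1/8)" "0 \<le> a^2"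
      using assms by (simp_all add: eval_nat_numeral mult_left_mono)
    then show ?thesis using assms by linarith
  qed
  have "log_tail (-1/40) a - log_tail (-1/40) (a / (1 + a)) \<le> a * (a - a^2/2 + a^3/3 - a^4/4 + a^5/5 - a^6/6)"
  proof -
    have "(1 + a)^4 * (log_tail (-1/40) a - log_tail (-1/40) (a / (1 + a)) - a * (a - a^2/2 + a^3/3 - a^4/4 + a^5/5 - a^6/6))
       = a^5 * (-1/60 + 1/90 * a - 7/180 * a^2 + 13/120 * a^3 + 9/20 * a^4 + 7/15 * a^5 + 1/6 * a^6)"
      unfolding right_diff_distrib log_tail_step[OF assms(1)]
      unfolding log_tail_def by (simp add: eval_nat_numeral field_simps)
    also have "\<dots> \<le> 0" using q assms by (simp add: mult_le_0_iff)
    finally show ?thesis using assms by (simp add: mult_le_0_iff)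
  qed
  also have "\<dots> \<le> a * ln (1 + a)"
    using assms by (intro mult_left_mono ln_one_plus_ge_poly6) auto
  finally show ?thesis .
qed

text \<open>Likewise $\sum_{k\ge n} k^{-2} = a + a^2/2 + a^3/6 - a^5/30 + \dots$ for $a = 1/n$.\<close>
definition sq_tail :: "real \<Rightarrow> real \<Rightarrow> real" where
  "sq_tail c a = a + a^2/2 + a^3/6 + c * a^5"

lemma sq_tail_step:
  fixes a :: real
  assumes "a > 0"
  shows "(1 + a)^5 * sq_tail c (a / (1 + a)) = a * (1 + a)^4 + a^2 * (1 + a)^3 / 2 + a^3 * (1 + a)^2 / 6 + c * a^5"
proof -
  define b where "b = a / (1 + a)"
  have ab: "a = b * (1 + a)" using assms by (simp add: b_def)
  have "(1 + a)^5 * sq_tail c b = (b * (1 + a)) * (1 + a)^4 + (b * (1 + a))^2 * (1 + a)^3 / 2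
      + (b * (1 + a))^3 * (1 + a)^2 / 6 + c * (b * (1 + a))^5"
    by (simp add: sq_tail_def power_mult_distrib eval_nat_numeral field_simps)
  then show ?thesis
    by (simp only: ab[symmetric] flip: b_def)
qed

text \<open>The a^5 term of the expansion is negative, so omitting it gives an upper bound.\<close>

lemma sq_tail_upper:
  fixes a :: real
  assumes "0 < a"
  shows "a^2 \<le> sq_tail 0 a - sq_tail 0 (a / (1 + a))"
proof -
  have "(1 + a)^5 * (sq_tail 0 a - sq_tail 0 (a / (1 + a)) - a^2) = a^6 * (1 + a)^2 / 6"
    unfolding right_diff_distrib sq_tail_step[OF assms(1)]
    unfolding sq_tail_def by (simp add: eval_nat_numeral field_simps)
  also have "\<dots> \<ge> 0" by simp
  finally show ?thesis using assms by (simp add: zero_le_mult_iff)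
qed

text \<open>With the exact coefficient -1/30 the orders below a^8 cancel; the sign of the rest
  reflects the next Euler-Maclaurin term a^7/42, which is positive and omitted.\<close>

lemma sq_tail_lower:
  fixes a :: real
  assumes "0 < a"
  shows "sq_tail (-1/30) a - sq_tail (-1/30) (a / (1 + a)) \<le> a^2"
proof -
  have "(1 + a)^5 * (sq_tail (-1/30) a - sq_tail (-1/30) (a / (1 + a)) - a^2)
      = - (a^8 * (1/6 + 1/6 * a + 1/30 * a^2))"
    unfolding right_diff_distrib sq_tail_step[OF assms(1)]
    unfolding sq_tail_def by (simp add: eval_nat_numeral field_simps)
  also have "\<dots> \<le> 0" using assms by simp
  finally show ?thesis using assms by (simp add: mult_le_0_iff)
qed

text \<open>This and the next six lemmas enclose ln(1+1/n) for n = 1, ..., 7 in windows of width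
  3e-8. The second argument of \<open>ln_approx_bounds\<close> counts the terms of the series in
  (x-1)/(x+1); fewer suffice as x approaches 1.\<close>

lemma ln_bounds_1: "0.69314717 \<le> ln (2 :: real)" "ln (2 :: real) \<le> 0.69314720"
  using ln_approx_bounds[of "2" 8] by (simp_all add: eval_nat_numeral)

lemma ln_bounds_2: "0.40546509 \<le> ln (3/2 :: real)" "ln (3/2 :: real) \<le> 0.40546512"
  using ln_approx_bounds[of "3/2" 6] by (simp_all add: eval_nat_numeral)

lemma ln_bounds_3: "0.28768206 \<le> ln (4/3 :: real)" "ln (4/3 :: real) \<le> 0.28768209"
  using ln_approx_bounds[of "4/3" 5] by (simp_all add: eval_nat_numeral)

lemma ln_bounds_4: "0.22314354 \<le> ln (5/4 :: real)" "ln (5/4 :: real) \<le> 0.22314357"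
  using ln_approx_bounds[of "5/4" 4] by (simp_all add: eval_nat_numeral)

lemma ln_bounds_5: "0.18232154 \<le> ln (6/5 :: real)" "ln (6/5 :: real) \<le> 0.18232157"
  using ln_approx_bounds[of "6/5" 4] by (simp_all add: eval_nat_numeral)

lemma ln_bounds_6: "0.15415066 \<le> ln (7/6 :: real)" "ln (7/6 :: real) \<le> 0.15415069"
  using ln_approx_bounds[of "7/6" 4] by (simp_all add: eval_nat_numeral)

lemma ln_bounds_7: "0.13353138 \<le> ln (8/7 :: real)" "ln (8/7 :: real) \<le> 0.13353141"
  using ln_approx_bounds[of "8/7" 3] by (simp_all add: eval_nat_numeral)

lemma tail_tendsto_0:
  shows log_tail_tendsto_0: "(\<lambda>k. log_tail c (1 / real (Suc k))) \<longlonglongrightarrow> 0"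
    and sq_tail_tendsto_0: "(\<lambda>k. sq_tail c (1 / real (Suc k))) \<longlonglongrightarrow> 0"
proof -
  have "((\<lambda>k. log_tail c (X k)) \<longlonglongrightarrow> 0) \<and> ((\<lambda>k. sq_tail c (X k)) \<longlonglongrightarrow> 0)"
    if "X \<longlonglongrightarrow> 0" for X :: "nat \<Rightarrow> real"
    using that unfolding log_tail_def sq_tail_def by (auto intro!: tendsto_eq_intros)
  moreover have "(\<lambda>k. 1 / real (Suc k)) \<longlonglongrightarrow> 0"
    using LIMSEQ_inverse_real_of_nat by (simp only: inverse_eq_divide)
  ultimately show "(\<lambda>k. log_tail c (1 / real (Suc k))) \<longlonglongrightarrow> 0"
    and "(\<lambda>k. sq_tail c (1 / real (Suc k))) \<longlonglongrightarrow> 0" by blast+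
qed

text \<open>Brings \<open>F (Suc k)\<close> of the telescoping bounds into the form a/(1+a) of the
  tail estimates.\<close>

lemma inverse_Suc_Suc: "1 / real (Suc (Suc k)) = (1 / real (Suc k)) / (1 + 1 / real (Suc k))"
  by (simp add: field_simps)

lemma ln_series_bounds:
  assumes "(\<lambda>k. 1 / real (Suc k) * ln (1 + 1 / real (Suc k))) sums s"
  shows "s \<in> {1.257745..1.257748}"
proof -
  have small: "1 / real (Suc k) \<le> 1 / 8" if "7 \<le> k" for k
    using that by (simp add: field_simps)
  \<comment> \<open>Index k stands for n = k+1, so after seven terms the tail starts at n = 8, that
    is a = 1/8, where the tail estimates begin to hold.\<close>
  have "s \<le> (\<Sum>k<7. 1 / real (Suc k) * ln (1 + 1 / real (Suc k))) + log_tail (-1/50) (1 / real (Suc 7))"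
    by (rule sums_le_partial_plus_telescope[OF assms _ log_tail_tendsto_0])
      (unfold inverse_Suc_Suc, intro log_tail_upper small, auto)
  moreover have "(\<Sum>k<7. 1 / real (Suc k) * ln (1 + 1 / real (Suc k))) + log_tail (-1/40) (1 / real (Suc 7)) \<le> s"
    by (rule sums_ge_partial_plus_telescope[OF assms _ log_tail_tendsto_0])
      (unfold inverse_Suc_Suc, intro log_tail_lower small, auto)
  moreover have "(\<Sum>k<7. 1 / real (Suc k) * ln (1 + 1 / real (Suc k)))
      = ln 2 + ln (3/2) / 2 + ln (4/3) / 3 + ln (5/4) / 4 + ln (6/5) / 5 + ln (7/6) / 6 + ln (8/7) / 7"
    by (simp add: eval_nat_numeral)
  moreover have "log_tail (-1/50) (1 / real (Suc 7)) \<le> 0.1289557" "0.1289543 \<le> log_tail (-1/40) (1 / real (Suc 7))"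
    by (simp_all add: log_tail_def eval_nat_numeral)
  ultimately show ?thesis
    using ln_bounds_1 ln_bounds_2 ln_bounds_3 ln_bounds_4 ln_bounds_5 ln_bounds_6 ln_bounds_7
    by simp
qed

lemma sq_series_bounds:
  assumes "(\<lambda>k. (1 / real (Suc k))\<^sup>2) sums z"
  shows "z \<in> {1.644934..1.644936}"
proof -
  have "z \<le> (\<Sum>k<7. (1 / real (Suc k))\<^sup>2) + sq_tail 0 (1 / real (Suc 7))"
    by (rule sums_le_partial_plus_telescope[OF assms _ sq_tail_tendsto_0])
      (unfold inverse_Suc_Suc, intro sq_tail_upper, auto)
  moreover have "(\<Sum>k<7. (1 / real (Suc k))\<^sup>2) + sq_tail (-1/30) (1 / real (Suc 7)) \<le> z"
    by (rule sums_ge_partial_plus_telescope[OF assms _ sq_tail_tendsto_0])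
      (unfold inverse_Suc_Suc, intro sq_tail_lower, auto)
  ultimately show ?thesis
    by (simp add: sq_tail_def eval_nat_numeral)
qed

lemma ratio_bounds:
  assumes "(\<lambda>k. 1 / real (Suc k) * ln (1 + 1 / real (Suc k))) sums s"
    and "(\<lambda>k. (1 / real (Suc k))\<^sup>2) sums z"
  shows "\<bar>(1 + s) / ln 2 / z - 1.98016\<bar> < 1 / 100000"
proof -
  have s: "1.257745 \<le> s" "s \<le> 1.257748" and z: "1.644934 \<le> z" "z \<le> 1.644936"
    using ln_series_bounds[OF assms(1)] sq_series_bounds[OF assms(2)] by auto
  \<comment> \<open>Once the product in the denominator is enclosed, the claim on the quotient is
    linear.\<close>
  have "0.69314717 * 1.644934 \<le> ln 2 * z" "ln 2 * z \<le> 0.69314720 * 1.644936"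
    using z ln_bounds_1 by (intro mult_mono; simp)+
  moreover from this have "0 < ln 2 * z" by simp
  ultimately show ?thesis
    using s by (simp add: abs_less_iff field_simps)
qed

section \<open>Decay of the profiles\<close>

text \<open>Everything follows from ln y \<le> y - 1. With u = 1 - p, taking y = 1/sqrt u bounds -u
  ln u by 2 sqrt u, good for small x; taking y = 1/u bounds it by p, and exponential decay of p
  gives the bound for large x.\<close>

lemma hnat_exp_bounds:
  fixes x :: real
  assumes "x > 0"
  shows "0 \<le> hnat (exp (- x))"
    and "hnat (exp (- x)) \<le> x + 2 * sqrt x"
    and "hnat (exp (- x)) \<le> 2 / x"
proof -
  define p where "p = exp (- x)"
  define u where "u = 1 - p"
  have p: "0 < p" "p < 1" using assms by (auto simp: p_def)
  have u: "0 < u" "u < 1" "u \<le> x"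
    using p exp_ge_add_one_self[of "- x"] by (auto simp: u_def p_def)
  have h: "hnat (exp (- x)) = x * p - u * ln u"
    using p by (simp add: hnat_def u_def flip: p_def) (simp add: p_def)
  have "u * ln u \<le> 0" using u by (simp add: mult_le_0_iff)
  moreover have "0 \<le> x * p" using assms p by simp
  ultimately show "0 \<le> hnat (exp (- x))" unfolding h by linarith
  have "- ln (sqrt u) \<le> 1 / sqrt u"
    using ln_le_minus_one[of "1 / sqrt u"] u by (simp add: ln_div)
  then have "u * - ln u \<le> u * (2 * (1 / sqrt u))"
    using u by (intro mult_left_mono) (auto simp: ln_sqrt)
  also have "\<dots> = 2 * sqrt u"
    using u by (simp add: field_simps)
  also have "\<dots> \<le> 2 * sqrt x"
    using u by simp
  finally have "- (u * ln u) \<le> 2 * sqrt x" by simp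
  moreover have "x * p \<le> x"
    using assms p by (simp add: mult_le_cancel_left1)
  ultimately show "hnat (exp (- x)) \<le> x + 2 * sqrt x" unfolding h by linarith
  have "- ln u \<le> 1 / u - 1"
    using ln_le_minus_one[of "1 / u"] u by (simp add: ln_div)
  then have "u * - ln u \<le> u * (1 / u - 1)"
    using u by (intro mult_left_mono) auto
  also have "\<dots> = p" using u by (simp add: field_simps u_def)
  finally have "hnat (exp (- x)) \<le> (x + 1) * p" unfolding h by (simp add: algebra_simps)
  also have "\<dots> \<le> 2 / x"
  proof -
    have "1 + x + x\<^sup>2 / 2 \<le> exp x"
      using assms by (intro exp_lower_Taylor_quadratic) auto
    then have "(x + 1) * x \<le> 2 * exp x"
      using assms by (simp add: power2_eq_square algebra_simps)
    then show ?thesis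
      using assms by (simp add: p_def exp_minus field_simps)
  qed
  finally show "hnat (exp (- x)) \<le> 2 / x" .
qed

text \<open>The constant 27 is from e^x \<ge> (1 + x/3)^3, whose cubic coefficient is 1/27.\<close>

lemma gfun_bounds:
  fixes x :: real
  assumes "x > 0"
  shows "0 \<le> gfun x" "gfun x \<le> x" "gfun x \<le> 27 / x"
proof -
  have e: "0 < exp x - 1" using assms by simp
  show "0 \<le> gfun x" using e by (simp add: gfun_def)
  have "x \<le> exp x - 1" using exp_ge_add_one_self[of x] by linarith
  then have "x\<^sup>2 \<le> x * (exp x - 1)"
    unfolding power2_eq_square using assms by (intro mult_left_mono) auto
  then show "gfun x \<le> x" using e by (simp add: gfun_def divide_le_eq)
  have "(1 + x / 3) ^ 3 \<le> exp x"
    using exp_ge_one_plus_x_over_n_power_n[of 3 x] assms by simp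
  moreover have "(1 + x / 3) ^ 3 = 1 + x + x\<^sup>2 / 3 + x ^ 3 / 27"
    by (simp add: power2_eq_square power3_eq_cube field_simps)
  ultimately have "x ^ 3 \<le> 27 * (exp x - 1)"
    using assms zero_le_power2[of x] by argo
  then show "gfun x \<le> 27 / x"
    using e assms by (simp add: gfun_def field_simps power2_eq_square power3_eq_cube)
qed

text \<open>For x = e^w, sqrt x is exp(w/2) and 1/x is exp(-w). The square root is what absorbs the
  logarithm in the entropy, which behaves like -x ln x near 0; this fixes the rate 1/2.\<close>

lemma two_sided_decay:
  fixes f :: "real \<Rightarrow> real"
  assumes C: "0 \<le> C"
    and small: "\<And>x. 0 < x \<Longrightarrow> x \<le> 1 \<Longrightarrow> f x \<le> C * sqrt x"
    and large: "\<And>x. 1 \<le> x \<Longrightarrow> f x \<le> C / x"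
  shows "f (exp w) \<le> C * exp (- \<bar>w\<bar> / 2)"
proof (cases "w \<le> 0")
  case True
  have "(exp (w / 2))\<^sup>2 = exp w"
    by (simp flip: exp_double)
  then have "sqrt (exp w) = exp (w / 2)"
    by (metis abs_of_pos exp_gt_zero real_sqrt_abs)
  then show ?thesis
    using small[of "exp w"] True by simp
next
  case False
  have "C * exp (- w) \<le> C * exp (- \<bar>w\<bar> / 2)"
    using False C by (intro mult_left_mono) auto
  then have "C / exp w \<le> C * exp (- \<bar>w\<bar> / 2)"
    by (simp only: exp_minus divide_inverse)
  then show ?thesis
    using large[of "exp w"] False by simp
qed

lemma H0_integrand_nonneg: "0 \<le> H0_integrand w"
  by (simp add: H0_integrand_def hnat_exp_bounds)

lemma I0_integrand_nonneg: "0 \<le> I0_integrand w"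
  by (simp add: I0_integrand_def gfun_bounds)

lemma H0_integrand_decay: "H0_integrand w \<le> 3 * exp (- \<bar>w\<bar> / 2)"
  unfolding H0_integrand_def
proof (rule two_sided_decay)
  fix x :: real
  show "hnat (exp (- x)) \<le> 3 * sqrt x" if "0 < x" "x \<le> 1"
  proof -
    have "x \<le> sqrt x" using that by (intro real_le_rsqrt) (simp add: power2_eq_square mult_le_cancel_left1)
    then show ?thesis using hnat_exp_bounds(2)[of x] that by linarith
  qed
  show "hnat (exp (- x)) \<le> 3 / x" if "1 \<le> x"
    using hnat_exp_bounds(3)[of x] that by (smt (verit) divide_right_mono)
qed simp

lemma I0_integrand_decay: "I0_integrand w \<le> 27 * exp (- \<bar>w\<bar> / 2)"
  unfolding I0_integrand_def
proof (rule two_sided_decay)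
  fix x :: real
  show "gfun x \<le> 27 * sqrt x" if "0 < x" "x \<le> 1"
  proof -
    have "x \<le> sqrt x" using that by (intro real_le_rsqrt) (simp add: power2_eq_square mult_le_cancel_left1)
    then show ?thesis using gfun_bounds(2)[of x] that by (smt (verit) real_sqrt_ge_zero)
  qed
  show "gfun x \<le> 27 / x" if "1 \<le> x"
    using gfun_bounds(3)[of x] that by simp
qed simp

lemma borel_measurable_integrands [measurable]:
  "H0_integrand \<in> borel_measurable borel" "I0_integrand \<in> borel_measurable borel"
  unfolding H0_integrand_def[abs_def] hnat_def[abs_def] I0_integrand_def[abs_def] gfun_def[abs_def]
  by measurable

section \<open>The q-PCSA sketch\<close>

lemma divide_powi_eq_exp:
  fixes q t :: real
  assumes "q > 0" "t > 0"
  shows "t / q powi k = exp (ln t - of_int k * ln q)"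
proof -
  have "q powi k = exp (of_int k * ln q)"
    using assms powr_real_of_int'[of q k] by (simp add: powr_def)
  then show ?thesis
    using assms by (simp add: exp_diff)
qed

text \<open>The factor \<open>1 / ln 2\<close> converts nats to bits.\<close>

lemma pcsa_coord_entropy_eq:
  assumes "q > 0" "t > 0"
  shows "pcsa_coord_entropy q k t = (1 / ln 2) * H0_integrand (ln t - of_int k * ln q)"
  by (simp add: pcsa_coord_entropy_def pcsa_p0_def bit_entropy_def xlog2_def H0_integrand_def hnat_def
      log_def diff_divide_distrib flip: divide_powi_eq_exp[OF assms])

text \<open>The two outcomes together give p / (c^2 (1-p)) = c^(-2) / (1/p - 1); pulling out 1/t^2
  leaves \<open>gfun\<close> at t/c.\<close>

lemma pcsa_coord_fisher_eq:
  assumes "q > 0" "t > 0"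
  shows "pcsa_coord_fisher q k t = (1 / t\<^sup>2) * I0_integrand (ln t - of_int k * ln q)"
proof -
  define c where "c = q powi k"
  define p where "p = exp (- t / c)"
  have c: "c > 0" using assms by (simp add: c_def)
  have p: "0 < p" "p < 1" using assms c by (auto simp: p_def)
  have "((\<lambda>l. exp (- l / c)) has_real_derivative - p / c) (at t)"
    and "((\<lambda>l. 1 - exp (- l / c)) has_real_derivative p / c) (at t)"
    unfolding p_def using c by (auto intro!: derivative_eq_intros)
  then have "pcsa_coord_fisher q k t = (- p / c)\<^sup>2 / p + (p / c)\<^sup>2 / (1 - p)"
    by (simp add: pcsa_coord_fisher_def pcsa_p0_def DERIV_imp_deriv p_def flip: c_def)
  also have "\<dots> = (1 / t\<^sup>2) * ((t / c)\<^sup>2 / (1 / p - 1))"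
    using p c assms by (simp add: field_simps power2_eq_square)
  also have "1 / p = exp (t / c)"
    by (simp add: p_def exp_minus inverse_eq_divide)
  also have "(t / c)\<^sup>2 / (exp (t / c) - 1) = I0_integrand (ln t - of_int k * ln q)"
    by (simp add: I0_integrand_def gfun_def c_def flip: divide_powi_eq_exp[OF assms])
  finally show ?thesis .
qed

lemma infsum_int_translates_shift:
  fixes \<phi> :: "real \<Rightarrow> 'a :: {comm_monoid_add, t2_space}"
  shows "(\<Sum>\<^sub>\<infinity>k\<in>(UNIV::int set). \<phi> (L + s - of_int k * L)) = (\<Sum>\<^sub>\<infinity>k\<in>(UNIV::int set). \<phi> (s - of_int k * L))"
proof -
  have "bij (\<lambda>k::int. k + 1)"
    by (rule bij_betw_byWitness[where f' = "\<lambda>k. k - 1"]) auto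
  from infsum_reindex_bij_betw[OF this, of "\<lambda>k. \<phi> (L + s - of_int k * L)", symmetric]
  show ?thesis by (simp add: algebra_simps)
qed

theorem mainTheorem1:
  fixes q :: real
  assumes "q > 1"
  shows "weakly_scale_invariant q (pcsa_H q) (pcsa_I q)
       \<and> (\<forall>t>0. (\<lambda>k. pcsa_coord_entropy q k t) summable_on (UNIV::int set)
                \<and> (\<lambda>k. pcsa_coord_fisher q k t) summable_on (UNIV::int set))
       \<and> H0_integrand integrable_on UNIV \<and> I0_integrand integrable_on UNIV
       \<and> ((\<lambda>r. pcsa_H q (q powr r)) has_integral (H0 / ln q)) {0..1}
       \<and> ((\<lambda>r. q powr (2 * r) * pcsa_I q (q powr r)) has_integral (I0 / ln q)) {0..1}
       \<and> calH q (pcsa_H q) = H0 / ln q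
       \<and> calI q (pcsa_I q) = I0 / ln q
       \<and> Fish q (pcsa_H q) (pcsa_I q) = H0 / I0
       \<and> \<bar>H0 / I0 - 1.98016\<bar> < 1 / 100000"
proof -
  define L where "L = ln q"
  have q: "q > 0" and L: "L > 0" using assms by (auto simp: L_def)
  have sH: "(\<lambda>k::int. H0_integrand (s - of_int k * L)) summable_on UNIV"
    and sI: "(\<lambda>k::int. I0_integrand (s - of_int k * L)) summable_on UNIV" for s
    using summable_on_int_translates[OF H0_integrand_nonneg H0_integrand_decay L]
      summable_on_int_translates[OF I0_integrand_nonneg I0_integrand_decay L] by blast+
  have summ: "\<forall>t>0. (\<lambda>k. pcsa_coord_entropy q k t) summable_on (UNIV::int set)
                \<and> (\<lambda>k. pcsa_coord_fisher q k t) summable_on (UNIV::int set)"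
    using q sH sI
    by (auto simp: pcsa_coord_entropy_eq pcsa_coord_fisher_eq simp del: times_divide_eq_left mult_1_left
        simp flip: L_def intro!: summable_on_cmult_right)
  have H_eq: "pcsa_H q t = (1 / ln 2) * (\<Sum>\<^sub>\<infinity>k\<in>(UNIV::int set). H0_integrand (ln t - of_int k * L))"
    and I_eq: "pcsa_I q t = (1 / t\<^sup>2) * (\<Sum>\<^sub>\<infinity>k\<in>(UNIV::int set). I0_integrand (ln t - of_int k * L))"
    if "t > 0" for t
    unfolding pcsa_H_def pcsa_I_def L_def pcsa_coord_entropy_eq[OF q that] pcsa_coord_fisher_eq[OF q that]
    by (rule infsum_cmult_right')+
  have ln_qt: "ln (q * t) = L + ln t" if "t > 0" for t
    using q that by (simp add: L_def ln_mult)
  \<comment> \<open>Passing from t to q t adds the period L to ln t, which leaves both sums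
    unchanged; the prefactor 1/t^2 accounts for q^2.\<close>
  have inv: "weakly_scale_invariant q (pcsa_H q) (pcsa_I q)"
    unfolding weakly_scale_invariant_def
    using q assms by (simp add: H_eq I_eq ln_qt infsum_int_translates_shift power_mult_distrib)
  define s where "s = (\<Sum>k. 1 / real (Suc k) * ln (1 + 1 / real (Suc k)))"
  define z where "z = (\<Sum>k. (1 / real (Suc k))\<^sup>2)"
  have s0: "0 \<le> s" and z0: "0 \<le> z"
    unfolding s_def z_def
    by (intro suminf_nonneg ln_series_summable inverse_squares_summable; simp)+
  have nH: "(\<integral>\<^sup>+w. ennreal (H0_integrand w) \<partial>lborel) = ennreal (1 + s)"
    and nI: "(\<integral>\<^sup>+w. ennreal (I0_integrand w) \<partial>lborel) = ennreal z"
    unfolding s_def z_def by (rule nn_integral_H0_integrand nn_integral_I0_integrand)+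
  have iH: "(H0_integrand has_integral (1 + s)) UNIV" and iI: "(I0_integrand has_integral z) UNIV"
    using nn_integral_has_integral[OF _ H0_integrand_nonneg nH]
      nn_integral_has_integral[OF _ I0_integrand_nonneg nI] s0 z0 by auto
  have H0_eq: "H0 = (1 / ln 2) * (1 + s)" and I0_eq: "I0 = z"
    using iH iI by (simp_all add: H0_def I0_def integral_unique)
  have hH: "((\<lambda>r. pcsa_H q (q powr r)) has_integral (H0 / ln q)) {0..1}"
  proof -
    \<comment> \<open>At t = q^r one has ln t = r L, so r in [0, 1] runs through exactly one
      period.\<close>
    have "((\<lambda>r. (1 / ln 2) * (\<Sum>\<^sub>\<infinity>k\<in>(UNIV::int set). H0_integrand (r * L - of_int k * L)))
        has_integral ((1 / ln 2) * ((1 + s) / L))) {0..1}"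
      using s0 by (intro has_integral_mult_right has_integral_periodization H0_integrand_nonneg sH L nH) auto
    then show ?thesis
      using q by (simp add: H_eq H0_eq ln_powr L_def)
  qed
  have hI: "((\<lambda>r. q powr (2 * r) * pcsa_I q (q powr r)) has_integral (I0 / ln q)) {0..1}"
  proof -
    have "((\<lambda>r. (\<Sum>\<^sub>\<infinity>k\<in>(UNIV::int set). I0_integrand (r * L - of_int k * L)))
        has_integral (z / L)) {0..1}"
      using z0 by (intro has_integral_periodization I0_integrand_nonneg sI L nI) auto
    \<comment> \<open>The weight q^(2r) equals t^2 at t = q^r and cancels the prefactor 1/t^2 of the
      Fisher information.\<close>
    moreover have "q powr (2 * r) = (q powr r)\<^sup>2" for r
      using q by (simp add: power2_eq_square flip: powr_add)
    ultimately show ?thesis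
      using q by (simp add: I_eq I0_eq ln_powr L_def)
  qed
  have cH: "calH q (pcsa_H q) = H0 / ln q" and cI: "calI q (pcsa_I q) = I0 / ln q"
    using hH hI by (simp_all add: calH_def calI_def integral_unique)
  have F: "Fish q (pcsa_H q) (pcsa_I q) = H0 / I0"
    using L by (simp add: Fish_def cH cI flip: L_def)
  have "\<bar>H0 / I0 - 1.98016\<bar> < 1 / 100000"
    using ratio_bounds[of s z] summable_sums[OF ln_series_summable] summable_sums[OF inverse_squares_summable]
    by (simp add: H0_eq I0_eq s_def z_def)
  with inv summ iH iI hH hI cH cI F show ?thesis
    by (blast intro: has_integral_integrable)
qed

end
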